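(* The set $\mathcal{T}_{24}$ of 24 Wang tiles (encoding Penrose tilings), consisting of the following tuples (east, north, west, south), $$(A,A,D,D),\ (C,C,B,B),\ (E,E,I,I),\ (J,J,F,F),\ (C,C,H,H),\ (G,G,D,D),$$ $$(H,H,A,A),\ (B,B,G,G),\ (F,G,E,C),\ (F,D,E,H),\ (G,F,C,E),\ (D,F,H,E),$$ $$(B,I,C,F),\ (D,E,A,J),\ (I,B,F,C),\ (E,D,J,A),\ (H,C,B,A),\ (C,H,A,B),$$ $$(B,A,D,G),\ (A,B,G,D),\ (D,F,B,J),\ (A,I,C,E),\ (F,D,J,B),\ (I,A,E,C),$$ where $A,B,C,D,E,F,G,H,I,J$ are ten distinct symbols, admits no periodic tiling, i.e. no valid configuration $w:\mathbb{Z}^2\to\mathcal{T}_{24}$ is periodic.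
   Context: A Wang tile is a tuple $(a,b,c,d)$ where $a,b,c,d$ are the labels of the right (east), top (north), left (west) and bottom (south) edges of a unit square. For a finite set $\mathcal{T}$ of Wang tiles, a configuration $w:\mathbb{Z}^2\to\mathcal{T}$ is valid if for all $n\in\mathbb{Z}^2$ the east label of $w_n$ equals the west label of $w_{n+(1,0)}$ and the north label of $w_n$ equals the south label of $w_{n+(0,1)}$. It is periodic if there is $p\in\mathbb{Z}^2\setminus\{0\}$ with $w_{n+p}=w_n$ for all $n$. *)

theory Defs
  imports Main "HOL-Library.Product_Plus"
begin

text \<open>A tile is the tuple (east, north, west, south) of its edge labels.\<close>

type_synonym 'c wang_tile = "'c \<times> 'c \<times> 'c \<times> 'c"

fun east :: "'c wang_tile \<Rightarrow> 'c" where "east (a, b, c, d) = a"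
fun north :: "'c wang_tile \<Rightarrow> 'c" where "north (a, b, c, d) = b"
fun west :: "'c wang_tile \<Rightarrow> 'c" where "west (a, b, c, d) = c"
fun south :: "'c wang_tile \<Rightarrow> 'c" where "south (a, b, c, d) = d"

definition valid_configuration :: "'c wang_tile set \<Rightarrow> (int \<times> int \<Rightarrow> 'c wang_tile) \<Rightarrow> bool" where
  "valid_configuration T w \<longleftrightarrow>
     (\<forall>n. w n \<in> T) \<and>
     (\<forall>n. east (w n) = west (w (n + (1, 0)))) \<and>
     (\<forall>n. north (w n) = south (w (n + (0, 1))))"

definition periodic_configuration :: "(int \<times> int \<Rightarrow> 'c wang_tile) \<Rightarrow> bool" where
  "periodic_configuration w \<longleftrightarrow> (\<exists>p. p \<noteq> 0 \<and> (\<forall>n. w (n + p) = w n))"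

datatype label = A | B | C | D | E | F | G | H | I | J

definition T24 :: "label wang_tile set" where
  "T24 =
    {(A,A,D,D), (C,C,B,B), (E,E,I,I), (J,J,F,F), (C,C,H,H), (G,G,D,D),
     (H,H,A,A), (B,B,G,G), (F,G,E,C), (F,D,E,H), (G,F,C,E), (D,F,H,E),
     (B,I,C,F), (D,E,A,J), (I,B,F,C), (E,D,J,A), (H,C,B,A), (C,H,A,B),
     (B,A,D,G), (A,B,G,D), (D,F,B,J), (A,I,C,E), (F,D,J,B), (I,A,E,C)}"

lemma card_T24: "card T24 = 24"
  by (simp add: T24_def)

end

theory Submission
  imports Defs
begin

text \<open>
  The labels \<open>E, F, I, J\<close> mark the short columns and rows, so every column and every row of a valid
  configuration is either long or short. The two tile weights
  \<open>[long column] - [long row]\<close> and \<open>[long column][long row] + [long row] - 1\<close>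
  are coboundaries: on each tile they equal the change of one potential from south to north plus
  the change of another from west to east. Summed over an \<open>n \<times> n\<close> square, both are therefore
  \<open>O(n)\<close>. If the square has \<open>a\<close> long columns and \<open>b\<close> long rows, this says \<open>a - b = O(1)\<close> and
  \<open>a b + n b - n\<^sup>2 = O(n)\<close>, so the densities of long columns and of long rows both
  solve \<open>x\<^sup>2 + x = 1\<close>. A period would make one of them rational.
\<close>

definition long :: "label \<Rightarrow> int" where
  "long l = (if l \<in> {E, F, I, J} then 0 else 1)"

lemma long_nonneg: "0 \<le> long l"
  and long_le_1: "long l \<le> 1"
  by (auto simp: long_def)

lemma long_T24:
  assumes "t \<in> T24"
  shows "long (north t) = long (south t)" and "long (east t) = long (west t)"
  using assms by (auto simp: T24_def long_def)

text \<open>Twice the potentials, found by solving a linear system over the 24 tiles.\<close>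

fun pot1 :: "label \<Rightarrow> int" where
  "pot1 A = 2" | "pot1 B = 1" | "pot1 C = 1" | "pot1 D = -1" | "pot1 E = -1"
| "pot1 F = 0" | "pot1 G = 0" | "pot1 H = 0" | "pot1 I = 2" | "pot1 J = 0"

fun pot2_ns :: "label \<Rightarrow> int" where
  "pot2_ns A = -2" | "pot2_ns B = -1" | "pot2_ns C = 1" | "pot2_ns D = -3" | "pot2_ns E = 1"
| "pot2_ns F = 2" | "pot2_ns G = -2" | "pot2_ns H = 0" | "pot2_ns I = 2" | "pot2_ns J = 0"

fun pot2_ew :: "label \<Rightarrow> int" where
  "pot2_ew A = 0" | "pot2_ew B = 1" | "pot2_ew C = 1" | "pot2_ew D = -1" | "pot2_ew E = -1"
| "pot2_ew F = 0" | "pot2_ew G = 0" | "pot2_ew H = 0" | "pot2_ew I = 0" | "pot2_ew J = 0"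

lemma pot_bounds: "\<bar>pot1 l\<bar> \<le> 3" "\<bar>pot2_ns l\<bar> \<le> 3" "\<bar>pot2_ew l\<bar> \<le> 3"
  by (cases l; simp)+

text \<open>The same potential \<open>pot1\<close> serves both directions, with opposite signs. The
  double negation keeps the shape \<open>P (north t) - P (south t)\<close> for
  \<open>P = (\<lambda>l. - pot1 l)\<close>, as \<open>sum_coboundary_bound\<close> expects.\<close>

lemma weight1_coboundary:
  assumes "t \<in> T24"
  shows "2 * (long (north t) - long (east t)) =
    - pot1 (north t) - - pot1 (south t) + (pot1 (east t) - pot1 (west t))"
  using assms unfolding T24_def by (elim insertE emptyE) (simp_all add: long_def)

lemma weight2_coboundary:
  assumes "t \<in> T24"
  shows "2 * (long (north t) * long (east t) + long (east t) - 1) =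
    pot2_ns (north t) - pot2_ns (south t) + (pot2_ew (east t) - pot2_ew (west t))"
  using assms unfolding T24_def by (elim insertE emptyE) (simp_all add: long_def)

text \<open>The differences telescope along columns and rows, so only the four sides of the square
  remain. Each side contributes at most \<open>K * int n\<close>; halving the total gives the
  bound.\<close>

lemma sum_coboundary_bound:
  fixes w :: "int \<times> int \<Rightarrow> 'c wang_tile" and f :: "'c wang_tile \<Rightarrow> int" and P Q :: "'c \<Rightarrow> int"
  assumes valid: "valid_configuration T w"
    and cobound: "\<And>t. t \<in> T \<Longrightarrow> 2 * f t = P (north t) - P (south t) + (Q (east t) - Q (west t))"
    and P: "\<And>l. \<bar>P l\<bar> \<le> K" and Q: "\<And>l. \<bar>Q l\<bar> \<le> K"
  shows "\<bar>\<Sum>i<n. \<Sum>j<n. f (w (int i, int j))\<bar> \<le> 2 * K * int n"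
proof -
  define p where "p i j = P (south (w (int i, int j)))" for i j
  define q where "q i j = Q (west (w (int i, int j)))" for i j
  have f: "2 * f (w (int i, int j)) = (p i (Suc j) - p i j) + (q (Suc i) j - q i j)" for i j
  proof -
    have "w (int i, int j) \<in> T" "north (w (int i, int j)) = south (w (int i, int (Suc j)))"
      "east (w (int i, int j)) = west (w (int (Suc i), int j))"
      using valid by (simp_all add: valid_configuration_def add.commute)
    then show ?thesis
      using cobound by (simp add: p_def q_def)
  qed
  have "2 * (\<Sum>i<n. \<Sum>j<n. f (w (int i, int j))) =
      (\<Sum>i<n. \<Sum>j<n. p i (Suc j) - p i j) + (\<Sum>i<n. \<Sum>j<n. q (Suc i) j - q i j)"
    by (simp add: sum_distrib_left f sum.distrib)
  also have "(\<Sum>i<n. \<Sum>j<n. p i (Suc j) - p i j) = (\<Sum>i<n. p i n - p i 0)"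
    by (simp only: sum_lessThan_telescope)
  also have "(\<Sum>i<n. \<Sum>j<n. q (Suc i) j - q i j) = (\<Sum>j<n. \<Sum>i<n. q (Suc i) j - q i j)"
    by (rule sum.swap)
  also have "\<dots> = (\<Sum>j<n. q n j - q 0 j)"
    by (simp only: sum_lessThan_telescope[of "\<lambda>i. q i j" for j])
  finally have *: "2 * (\<Sum>i<n. \<Sum>j<n. f (w (int i, int j))) =
      (\<Sum>i<n. (p i n - p i 0) + (q n i - q 0 i))"
    by (simp add: sum.distrib)
  have "\<bar>(p i n - p i 0) + (q n i - q 0 i)\<bar> \<le> 4 * K" for i
    unfolding p_def q_def
    using P[of "south (w (int i, int n))"] P[of "south (w (int i, int 0))"]
      Q[of "west (w (int n, int i))"] Q[of "west (w (int 0, int i))"] by linarith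
  then have "\<bar>\<Sum>i<n. (p i n - p i 0) + (q n i - q 0 i)\<bar> \<le> (\<Sum>i<n. 4 * K)"
    by (intro order_trans[OF sum_abs] sum_mono)
  then have "\<bar>\<Sum>i<n. (p i n - p i 0) + (q n i - q 0 i)\<bar> \<le> 2 * (2 * K * int n)"
    by (simp add: mult_ac)
  then show ?thesis
    unfolding *[symmetric] by linarith
qed

lemma int_shift_invariant:
  fixes f :: "int \<Rightarrow> 'a"
  assumes "\<And>i. f (i + 1) = f i"
  shows "f i = f 0"
proof (induction i rule: int_induct[where k = 0])
  case (step2 i)
  then show ?case using assms[of "i - 1"] by simp
qed (simp_all add: assms)

text \<open>North edges within a column may carry different labels, but each tile has labels of the
  same class on its south and north edges, so the class passes up the whole column.\<close>

lemma long_column: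
  assumes "valid_configuration T24 w"
  shows "long (north (w (i, j))) = long (north (w (i, 0)))"
proof (rule int_shift_invariant[of "\<lambda>j. long (north (w (i, j)))"])
  fix j
  have "north (w (i, j)) = south (w (i, j + 1))" "w (i, j + 1) \<in> T24"
    using assms by (simp_all add: valid_configuration_def)
  then show "long (north (w (i, j + 1))) = long (north (w (i, j)))"
    by (simp add: long_T24)
qed

lemma long_row:
  assumes "valid_configuration T24 w"
  shows "long (east (w (i, j))) = long (east (w (0, j)))"
proof (rule int_shift_invariant[of "\<lambda>i. long (east (w (i, j)))"])
  fix i
  have "east (w (i, j)) = west (w (i + 1, j))" "w (i + 1, j) \<in> T24"
    using assms by (simp_all add: valid_configuration_def)
  then show "long (east (w (i + 1, j))) = long (east (w (i, j)))"
    by (simp add: long_T24)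
qed

text \<open>Over the square the two weights sum to \<open>int n * (a n - b n)\<close> and
  \<open>a n * b n + int n * b n - int n * int n\<close>. Potentials bounded by 3 make each at most
  \<open>2 * 3 * int n\<close> in absolute value.\<close>

lemma long_count_bounds:
  fixes w :: "int \<times> int \<Rightarrow> label wang_tile"
  assumes valid: "valid_configuration T24 w"
  defines "a \<equiv> \<lambda>n. \<Sum>i<n. long (north (w (int i, 0)))"
    and "b \<equiv> \<lambda>n. \<Sum>j<n. long (east (w (0, int j)))"
  shows "\<bar>a n * a n + int n * a n - int n * int n\<bar> \<le> 18 * int n"
    and "\<bar>b n * b n + int n * b n - int n * int n\<bar> \<le> 18 * int n"
proof -
  note types = long_column[OF valid, of "int i" "int j" for i j]
    long_row[OF valid, of "int i" "int j" for i j]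
  have "(\<Sum>i<n. \<Sum>j<n. long (north (w (int i, int j))) - long (east (w (int i, int j)))) =
      int n * (a n - b n)"
    by (simp add: types a_def b_def sum_subtractf right_diff_distrib sum_distrib_left)
  then have 1: "\<bar>int n * (a n - b n)\<bar> \<le> 6 * int n"
    using sum_coboundary_bound[OF valid weight1_coboundary, of 3 n] by (simp add: pot_bounds)
  have "(\<Sum>i<n. \<Sum>j<n. long (north (w (int i, int j))) * long (east (w (int i, int j)))
        + long (east (w (int i, int j))) - 1) = a n * b n + int n * b n - int n * int n"
    by (simp add: types a_def b_def sum_subtractf sum.distrib sum_product)
  then have 2: "\<bar>a n * b n + int n * b n - int n * int n\<bar> \<le> 6 * int n"
    using sum_coboundary_bound[OF valid weight2_coboundary, of 3 n] by (simp add: pot_bounds)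
  have a: "0 \<le> a n" "a n \<le> int n" and b: "0 \<le> b n" "b n \<le> int n"
    unfolding a_def b_def
    using sum_bounded_above[of "{..<n}" "\<lambda>i. long (north (w (int i, 0)))" 1]
      sum_bounded_above[of "{..<n}" "\<lambda>j. long (east (w (0, int j)))" 1]
    by (simp_all add: sum_nonneg long_nonneg long_le_1)
  \<comment> \<open>This controls the error of exchanging \<open>a n\<close> for \<open>b n\<close>
    next to a factor \<open>x\<close>, without dividing by \<open>n\<close>.\<close>
  have mul: "\<bar>x * (a n - b n)\<bar> \<le> 6 * int n" if "0 \<le> x" "x \<le> int n" for x
  proof -
    have "\<bar>x * (a n - b n)\<bar> \<le> \<bar>int n * (a n - b n)\<bar>"
      using that by (simp add: abs_mult mult_right_mono)
    with 1 show ?thesis by linarith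
  qed
  \<comment> \<open>Replacing \<open>b n\<close> by \<open>a n\<close> in both terms adds two errors
    of size \<open>6 * int n\<close>, hence the 18.\<close>
  have "a n * a n + int n * a n - int n * int n =
      (a n * b n + int n * b n - int n * int n) + a n * (a n - b n) + int n * (a n - b n)"
    by (simp add: algebra_simps)
  then show "\<bar>a n * a n + int n * a n - int n * int n\<bar> \<le> 18 * int n"
    using 1 2 mul[OF a] by linarith
  \<comment> \<open>Here only the product term changes, so the error is at most
    \<open>12 * int n\<close>.\<close>
  have "b n * b n + int n * b n - int n * int n =
      (a n * b n + int n * b n - int n * int n) - b n * (a n - b n)"
    by (simp add: algebra_simps)
  then show "\<bar>b n * b n + int n * b n - int n * int n\<bar> \<le> 18 * int n"
    using 2 mul[OF b] by linarith
qed

text \<open>Infinite descent: modulo 2 the equation forces both numbers to be even, and halving them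
  gives a smaller solution.\<close>

lemma golden_ratio_irrational:
  fixes q m :: int
  assumes "q * q + m * q = m * m"
  shows "m = 0"
  using assms
proof (induction "nat \<bar>m\<bar>" arbitrary: q m rule: less_induct)
  case less
  have "even (q * q + m * q) = even (m * m)"
    using less.prems by simp
  then have "even m" "even q"
    by auto
  then obtain m' q' where [simp]: "m = 2 * m'" "q = 2 * q'"
    by (auto elim!: evenE)
  show ?case
  proof (rule ccontr)
    assume "m \<noteq> 0"
    then have "nat \<bar>m'\<bar> < nat \<bar>m\<bar>"
      by simp
    moreover have "q' * q' + m' * q' = m' * m'"
      using less.prems by simp
    ultimately have "m' = 0"
      by (rule less.hyps)
    with \<open>m \<noteq> 0\<close> show False
      by simp
  qed
qed

lemma sum_periodic:
  fixes g :: "nat \<Rightarrow> int"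
  assumes "\<And>i. g (i + m) = g i"
  shows "(\<Sum>i<k * m. g i) = int k * (\<Sum>i<m. g i)"
proof -
  have shift: "g (i + j * m) = g i" for i j
  proof (induction j)
    case (Suc j)
    then show ?case using assms[of "i + j * m"] by (simp add: add_ac)
  qed simp
  have "sum g {j * m..<j * m + m} = (\<Sum>i<m. g i)" for j
    using sum.shift_bounds_nat_ivl[of g 0 "j * m" m]
    by (simp add: shift add.commute lessThan_atLeast0)
  then show ?thesis
    by (simp flip: sum.nat_group)
qed

text \<open>At the multiples \<open>k * m\<close> of a period \<open>m\<close> the quadratic
  expression is \<open>k * k\<close> times its value at \<open>m\<close>. A linear bound therefore
  forces that value to vanish, which makes the golden ratio rational unless
  \<open>m = 0\<close>.\<close>

lemma golden_density_not_periodic: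
  fixes f :: "int \<Rightarrow> int"
  defines "a \<equiv> \<lambda>n. \<Sum>i<n. f (int i)"
  assumes bound: "\<And>n. \<bar>a n * a n + int n * a n - int n * int n\<bar> \<le> K * int n"
    and period: "\<And>i. f (i + p) = f i"
  shows "p = 0"
proof -
  define m where "m = nat \<bar>p\<bar>"
  have "f (i + \<bar>p\<bar>) = f i" for i
    using period[of i] period[of "i - p"] by (cases "0 \<le> p") simp_all
  then have "f (int (i + m)) = f (int i)" for i
    by (simp add: m_def)
  then have a: "a (k * m) = int k * a m" for k
    unfolding a_def by (rule sum_periodic)
  define d where "d = a m * a m + int m * a m - int m * int m"
  have "d = 0"
  proof (rule ccontr)
    assume "d \<noteq> 0"
    have "0 \<le> K * int m"
      using bound[of m] by linarith
    \<comment> \<open>If \<open>d\<close> is nonzero, the bound at \<open>k * m\<close> gives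
      \<open>int k \<le> K * int m\<close>, so the next integer is already too large.\<close>
    define k where "k = nat (K * int m) + 1"
    have k: "int k = K * int m + 1"
      using \<open>0 \<le> K * int m\<close> by (simp add: k_def)
    have "a (k * m) * a (k * m) + int (k * m) * a (k * m) - int (k * m) * int (k * m) =
        int k * (int k * d)"
      by (simp add: a d_def algebra_simps)
    then have "\<bar>int k * (int k * d)\<bar> \<le> int k * (K * int m)"
      using bound[of "k * m"] by (simp add: mult_ac)
    then have "int k * \<bar>d\<bar> \<le> K * int m"
      using k \<open>0 \<le> K * int m\<close> by (simp add: abs_mult)
    moreover have "int k * 1 \<le> int k * \<bar>d\<bar>"
      using \<open>d \<noteq> 0\<close> by (intro mult_left_mono) auto
    ultimately show False
      using k by linarith
  qed
  then have "int m = 0"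
    by (intro golden_ratio_irrational[of "a m"]) (simp add: d_def)
  then show ?thesis
    by (simp add: m_def)
qed

theorem theorem4p2:
  shows "\<not> (\<exists>w :: int \<times> int \<Rightarrow> label wang_tile. valid_configuration T24 w \<and> periodic_configuration w)"
proof
  assume "\<exists>w :: int \<times> int \<Rightarrow> label wang_tile. valid_configuration T24 w \<and> periodic_configuration w"
  then obtain w :: "int \<times> int \<Rightarrow> label wang_tile" and p1 p2
    where valid: "valid_configuration T24 w" and nonzero: "(p1, p2) \<noteq> 0"
      and period: "\<And>n. w (n + (p1, p2)) = w n"
    unfolding periodic_configuration_def by auto
  \<comment> \<open>A vertical shift preserves the class of a column, so \<open>p1\<close> alone is
    a period of the column classes; likewise \<open>p2\<close> for rows.\<close>
  have "p1 = 0"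
  proof (rule golden_density_not_periodic)
    show "long (north (w (i + p1, 0))) = long (north (w (i, 0)))" for i
      using period[of "(i, 0)"] long_column[OF valid, of "i + p1" p2] by simp
  qed (rule long_count_bounds(1)[OF valid])
  moreover have "p2 = 0"
  proof (rule golden_density_not_periodic)
    show "long (east (w (0, j + p2))) = long (east (w (0, j)))" for j
      using period[of "(0, j)"] long_row[OF valid, of p1 "j + p2"] by simp
  qed (rule long_count_bounds(2)[OF valid])
  ultimately show False
    using nonzero by (simp add: zero_prod_def)
qed

end
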